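(* Let $a,b,c$ be real numbers with $(a,b)\neq(0,0)$, let $Q(x,y)=ax+by-c\in\mathbb{R}[x,y]$, and let $\mathcal{S}_E(Q)$ be the set of all regular tubular surfaces in Euclidean $3$-space whose Gaussian curvature $K$ and mean curvature $H$ satisfy $Q(K,H)\equiv0$. Then $\mathcal{S}_E(Q)\neq\emptyset$ if and only if $b=c=0$ or $bc>0$. More precisely, with $\Delta=b^2+4ac$: (i) if $b=c=0$, then $\mathcal{S}_E(Q)$ is the set of all right cylinders of any radius; (ii) if $bc>0$ and $\Delta=0$, then $\mathcal{S}_E(Q)$ is the set of all regular tubular surfaces of radius $\frac{b}{2c}$; (iii) if $bc>0$ and $\Delta\neq0$, then $\mathcal{S}_E(Q)$ is the set of all right cylinders of radius $\frac{b}{2c}$.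
   Context: Let $\gamma:(\alpha,\beta)\to\mathbb{E}^3$ be a smooth curve with nonzero tangent vectors (the central curve) and let $r>0$. The tubular surface of radius $r$ around $\gamma$ is the union of all circles of radius $r$ and center $\gamma(s)$ contained in the planes through $\gamma(s)$ normal to $\gamma'(s)$, $s\in(\alpha,\beta)$; it is parametrized by the pairs $(s,v)$ with $v$ a unit vector orthogonal to $\gamma'(s)$, via $(s,v)\mapsto\gamma(s)+rv$. It is called regular if $\gamma$ is parametrized by arc length and $1-r\kappa(s)\cos t\neq0$ for all $(s,t)\in(\alpha,\beta)\times\mathbb{R}$, where $\kappa=\|\gamma''\|$; the parametrization is then an immersion, and $K$ and $H$ are the Gaussian and mean curvatures of this immersed surface, where $H$ is half the sum of the principal curvatures, computed with the unit normal $-v$ at the point $(s,v)$ (pointing toward the central curve; so a cylinder of radius $r$ has $K=0$, $H=\frac1{2r}$). A right cylinder is a regular tubular surface with $\kappa\equiv0$. *)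

theory Defs
  imports "HOL-Analysis.Analysis"
begin

section \<open>Curvatures of immersed surfaces\<close>

text \<open>
  The parameter domain \<open>D\<close> of a surface is an embedded two-dimensional submanifold of some
  normed space; \<open>f\<close> (the immersion) and \<open>N\<close> (a unit normal field along \<open>f\<close>) are maps
  that are differentiable on a neighbourhood of \<open>D\<close> in that ambient space. Only the values of
  their differentials on the tangent spaces of \<open>D\<close> matter.
\<close>

text \<open>
  The curves are only required to be differentiable at the one point; for an embedded
  submanifold this yields the same tangent space as smooth curves.
\<close>

definition tangent_space :: "'a::real_normed_vector set \<Rightarrow> 'a \<Rightarrow> 'a set" where
  "tangent_space D p =
     {w. \<exists>c. c 0 = p \<and> (\<forall>\<^sub>F t in nhds (0::real). c t \<in> D) \<and> (c has_vector_derivative w) (at 0)}"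

text \<open>
  The shape operator \<open>S\<close> at \<open>p\<close> acts on the tangent plane \<open>df (T\<^sub>p D)\<close> by
  \<open>S (df w) = - dN w\<close>. The principal curvatures \<open>k1\<close>, \<open>k2\<close> are its eigenvalues, counted with
  multiplicity, belonging to an orthonormal basis \<open>df w1\<close>, \<open>df w2\<close> of the tangent plane.
\<close>

definition principal_curvatures ::
  "'a::real_normed_vector set \<Rightarrow> ('a \<Rightarrow> real^3) \<Rightarrow> ('a \<Rightarrow> real^3) \<Rightarrow> 'a \<Rightarrow> real \<Rightarrow> real \<Rightarrow> bool"
  where
  "principal_curvatures D f N p k1 k2 \<longleftrightarrow>
     (let df = frechet_derivative f (at p); dN = frechet_derivative N (at p) in
      \<exists>w1\<in>tangent_space D p. \<exists>w2\<in>tangent_space D p.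
        norm (df w1) = 1 \<and> norm (df w2) = 1 \<and> df w1 \<bullet> df w2 = 0 \<and>
        - dN w1 = k1 *\<^sub>R df w1 \<and> - dN w2 = k2 *\<^sub>R df w2)"

definition gaussian_curvature ::
  "'a::real_normed_vector set \<Rightarrow> ('a \<Rightarrow> real^3) \<Rightarrow> ('a \<Rightarrow> real^3) \<Rightarrow> 'a \<Rightarrow> real" where
  "gaussian_curvature D f N p = (THE K. \<exists>k1 k2. principal_curvatures D f N p k1 k2 \<and> K = k1 * k2)"

definition mean_curvature ::
  "'a::real_normed_vector set \<Rightarrow> ('a \<Rightarrow> real^3) \<Rightarrow> ('a \<Rightarrow> real^3) \<Rightarrow> 'a \<Rightarrow> real" where
  "mean_curvature D f N p = (THE H. \<exists>k1 k2. principal_curvatures D f N p k1 k2 \<and> H = (k1 + k2) / 2)"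


section \<open>Tubular surfaces\<close>

text \<open>Only used at points of an open interval on which the curve is smooth.\<close>

definition nth_derivative :: "nat \<Rightarrow> (real \<Rightarrow> real^3) \<Rightarrow> real \<Rightarrow> real^3" where
  "nth_derivative n \<gamma> = ((\<lambda>g s. vector_derivative g (at s)) ^^ n) \<gamma>"

definition smooth_curve_on :: "real set \<Rightarrow> (real \<Rightarrow> real^3) \<Rightarrow> bool" where
  "smooth_curve_on I \<gamma> \<longleftrightarrow> (\<forall>n. \<forall>s\<in>I. nth_derivative n \<gamma> differentiable (at s))"

text \<open>
  A tubular surface is an immersed surface, which may intersect itself; it is therefore
  represented by the data defining its parametrization rather than by its set of points.
  The ends of the parameter interval may be infinite.
\<close>

record tube =
  left_end :: ereal
  right_end :: ereal
  central_curve :: "real \<Rightarrow> real^3"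
  radius :: real

definition param_interval :: "tube \<Rightarrow> real set" where
  "param_interval T = einterval (left_end T) (right_end T)"

definition tubular_surface :: "tube \<Rightarrow> bool" where
  "tubular_surface T \<longleftrightarrow>
     left_end T < right_end T \<and>
     smooth_curve_on (param_interval T) (central_curve T) \<and>
     (\<forall>s\<in>param_interval T. nth_derivative 1 (central_curve T) s \<noteq> 0) \<and>
     radius T > 0"

definition tube_domain :: "tube \<Rightarrow> (real \<times> (real^3)) set" where
  "tube_domain T =
     {(s, v). s \<in> param_interval T \<and> norm v = 1 \<and> v \<bullet> nth_derivative 1 (central_curve T) s = 0}"

definition tube_map :: "tube \<Rightarrow> real \<times> (real^3) \<Rightarrow> real^3" where
  "tube_map T = (\<lambda>(s, v). central_curve T s + radius T *\<^sub>R v)"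

definition tube_normal :: "real \<times> (real^3) \<Rightarrow> real^3" where
  "tube_normal = (\<lambda>(s, v). - v)"

definition tube_K :: "tube \<Rightarrow> real \<times> (real^3) \<Rightarrow> real" where
  "tube_K T = gaussian_curvature (tube_domain T) (tube_map T) tube_normal"

definition tube_H :: "tube \<Rightarrow> real \<times> (real^3) \<Rightarrow> real" where
  "tube_H T = mean_curvature (tube_domain T) (tube_map T) tube_normal"

text \<open>The curvature of the central curve, when that curve is parametrized by arc length.\<close>

definition curve_curvature :: "tube \<Rightarrow> real \<Rightarrow> real" where
  "curve_curvature T s = norm (nth_derivative 2 (central_curve T) s)"

definition regular_tubular_surface :: "tube \<Rightarrow> bool" where
  "regular_tubular_surface T \<longleftrightarrow>
     tubular_surface T \<and>
     (\<forall>s\<in>param_interval T. norm (nth_derivative 1 (central_curve T) s) = 1) \<and>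
     (\<forall>s\<in>param_interval T. \<forall>t. 1 - radius T * curve_curvature T s * cos t \<noteq> 0)"

definition right_cylinder :: "tube \<Rightarrow> bool" where
  "right_cylinder T \<longleftrightarrow>
     regular_tubular_surface T \<and> (\<forall>s\<in>param_interval T. curve_curvature T s = 0)"

definition weingarten_tubes :: "(real \<Rightarrow> real \<Rightarrow> real) \<Rightarrow> tube set" where
  "weingarten_tubes Q =
     {T. regular_tubular_surface T \<and> (\<forall>p\<in>tube_domain T. Q (tube_K T p) (tube_H T p) = 0)}"

end

theory Submission
  imports Defs
begin

text \<open>
  Let \<open>\<tau> = \<gamma>'\<close> and \<open>u = v \<bullet> \<gamma>''\<close>. At \<open>(s, v)\<close> the principal directions are \<open>\<tau> \<times> v\<close>, tangent to the
  circle, with principal curvature \<open>1 / r\<close>, and \<open>\<tau>\<close>, with principal curvature \<open>- u / (1 - r u)\<close>.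
  Clearing denominators, the relation \<open>a K + b H = c\<close> becomes
  \<open>b (1 - 2 r u) - 2 a u = 2 c r (1 - r u)\<close>. Every point \<open>\<gamma>(s)\<close> has normals \<open>v\<close> with \<open>u = 0\<close> and
  \<open>u = \<kappa>(s)\<close>. The first forces \<open>b = 2 c r\<close>, and then the second forces \<open>\<kappa> = 0\<close> or \<open>2 a + b r = 0\<close>;
  in the latter case \<open>\<Delta> = 0\<close> as soon as \<open>b = 2 c r \<noteq> 0\<close>.
\<close>

section \<open>Orthonormal vectors\<close>

lemma norm_cross3_orthonormal:
  assumes "norm \<tau> = 1" "norm v = 1" "v \<bullet> \<tau> = 0"
  shows "norm (cross3 \<tau> v) = 1"
proof -
  have "(norm (cross3 \<tau> v))\<^sup>2 = 1" using norm_cross[of \<tau> v] assms by (simp add: inner_commute)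
  then show ?thesis
    using norm_ge_zero[of "cross3 \<tau> v"] unfolding power2_eq_1_iff by linarith
qed

text \<open>With \<open>e = cross3 \<tau> v\<close>, the product of \<open>e\<close> with
  \<open>cross3 x e\<close> is computed in two ways from Lagrange's formula: directly as
  \<open>x - (e \<bullet> x) *\<^sub>R e\<close>, and, because \<open>x \<bullet> v = 0\<close>, as
  \<open>(x \<bullet> \<tau>) *\<^sub>R \<tau>\<close>.\<close>

lemma orthonormal_expansion_cross3:
  fixes x \<tau> v :: "real^3"
  assumes "norm \<tau> = 1" "norm v = 1" "v \<bullet> \<tau> = 0" "x \<bullet> v = 0"
  shows "x = (x \<bullet> \<tau>) *\<^sub>R \<tau> + (x \<bullet> cross3 \<tau> v) *\<^sub>R cross3 \<tau> v"
proof -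
  define e where "e = cross3 \<tau> v"
  have ee: "e \<bullet> e = 1"
    using norm_cross3_orthonormal[OF assms(1-3)] by (simp add: e_def norm_eq_1)
  have vv: "v \<bullet> v = 1" using assms(2) by (simp add: norm_eq_1)
  have xe: "cross3 x e = - ((x \<bullet> \<tau>) *\<^sub>R v)"
    unfolding e_def using assms by (simp add: Lagrange)
  have "cross3 v e = \<tau>" unfolding e_def using assms vv by (simp add: Lagrange)
  then have ev: "cross3 e v = - \<tau>" using cross_skew[of e v] by simp
  have "cross3 e (cross3 x e) = x - (e \<bullet> x) *\<^sub>R e" using ee by (simp add: Lagrange)
  moreover have "cross3 e (cross3 x e) = (x \<bullet> \<tau>) *\<^sub>R \<tau>"
    unfolding xe by (simp add: cross_minus_right cross_mult_right ev)
  ultimately show ?thesis unfolding e_def by (simp add: inner_commute algebra_simps)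
qed

text \<open>As \<open>f'\<close> is orthogonal to \<open>f t\<close>, the norm of \<open>f\<close>
  is stationary at \<open>t\<close>, so dividing by it has no first-order effect.\<close>

lemma has_vector_derivative_normalize:
  fixes f :: "real \<Rightarrow> 'a::real_inner"
  assumes f: "(f has_vector_derivative f') (at t)" and "norm (f t) = 1" "f t \<bullet> f' = 0"
  shows "((\<lambda>x. f x /\<^sub>R norm (f x)) has_vector_derivative f') (at t)"
proof -
  have fd: "(f has_derivative (\<lambda>h. h *\<^sub>R f')) (at t)"
    using f by (simp add: has_vector_derivative_def)
  have "f t \<noteq> 0" using assms(2) by auto
  then have "(norm has_derivative (\<lambda>h. sgn (f t) \<bullet> h)) (at (f t))"
    using has_derivative_norm[of "f t"] by (simp add: inner_commute)
  from has_derivative_compose[OF fd this]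
  have nd: "((\<lambda>x. norm (f x)) has_derivative (\<lambda>h. 0)) (at t)"
    using assms(3) by (simp add: sgn_div_norm)
  have "((\<lambda>x. inverse (norm (f x))) has_derivative (\<lambda>h. 0)) (at t)"
    using Deriv.has_derivative_inverse[OF _ nd] assms(2) by simp
  from has_derivative_scaleR[OF this fd] show ?thesis
    using assms(2) by (simp add: has_vector_derivative_def)
qed

text \<open>Two vectors span at most a plane. The dimension count also covers dependent vectors,
  whose cross product vanishes.\<close>

lemma exists_unit_orthogonal_to_two:
  fixes x y :: "real^3"
  obtains v where "norm v = 1" "v \<bullet> x = 0" "v \<bullet> y = 0"
proof -
  have "dim {x, y} \<le> card {x, y}" by (intro dim_le_card') simp
  also have "\<dots> \<le> 2" by (simp add: card_insert_if)
  finally have "dim {x, y} < DIM(real^3)" by simp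
  from orthogonal_to_subspace_exists[OF this] obtain z
    where z: "z \<noteq> 0" "\<And>w. w \<in> span {x, y} \<Longrightarrow> orthogonal z w" by blast
  have "z \<bullet> x = 0" "z \<bullet> y = 0"
    using z(2)[of x] z(2)[of y] by (auto simp: orthogonal_def span_base)
  then show ?thesis using z(1) that[of "z /\<^sub>R norm z"] by simp
qed

section \<open>Curvatures of regular tubular surfaces\<close>

locale regular_tube =
  fixes T :: tube
  assumes regular: "regular_tubular_surface T"
begin

abbreviation \<gamma> where "\<gamma> \<equiv> central_curve T"
abbreviation \<tau> where "\<tau> \<equiv> nth_derivative 1 \<gamma>"
abbreviation \<nu> where "\<nu> \<equiv> nth_derivative 2 \<gamma>"
abbreviation r where "r \<equiv> radius T"
abbreviation I where "I \<equiv> param_interval T"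

declare One_nat_def [simp del]

section \<open>The central curve and the regularity condition\<close>

lemma open_I: "open I"
  by (simp add: param_interval_def)

lemma I_nonempty: "I \<noteq> {}"
  using regular einterval_nonempty[of "left_end T" "right_end T"]
  by (auto simp: param_interval_def regular_tubular_surface_def tubular_surface_def)

lemma r_pos: "r > 0"
  using regular by (simp add: regular_tubular_surface_def tubular_surface_def)

lemma norm_tangent: "s \<in> I \<Longrightarrow> norm (\<tau> s) = 1"
  using regular by (simp add: regular_tubular_surface_def)

lemma tangent_tangent: "s \<in> I \<Longrightarrow> \<tau> s \<bullet> \<tau> s = 1"
  using norm_tangent by (simp add: norm_eq_1)

lemma nth_derivative_deriv:
  assumes "s \<in> I"
  shows "(nth_derivative n \<gamma> has_vector_derivative nth_derivative (Suc n) \<gamma> s) (at s)"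
proof -
  have "nth_derivative n \<gamma> differentiable (at s)"
    using regular assms
    by (auto simp: regular_tubular_surface_def tubular_surface_def smooth_curve_on_def)
  then show ?thesis by (simp add: vector_derivative_works nth_derivative_def)
qed

lemma curve_deriv: "s \<in> I \<Longrightarrow> (\<gamma> has_vector_derivative \<tau> s) (at s)"
  using nth_derivative_deriv[of s 0] by (simp add: nth_derivative_def One_nat_def)

lemma tangent_deriv: "s \<in> I \<Longrightarrow> (\<tau> has_vector_derivative \<nu> s) (at s)"
  using nth_derivative_deriv[of s 1] by (simp add: numeral_2_eq_2)

text \<open>Differentiate \<open>\<tau> x \<bullet> \<tau> x\<close>, which is constantly 1 on the
  open interval \<open>I\<close>.\<close>

lemma tangent_curvature_orthogonal:
  assumes s: "s \<in> I"
  shows "\<tau> s \<bullet> \<nu> s = 0"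
proof -
  have "((\<lambda>x. \<tau> x \<bullet> \<tau> x) has_vector_derivative \<tau> s \<bullet> \<nu> s + \<nu> s \<bullet> \<tau> s) (at s)"
    by (intro bounded_bilinear.has_vector_derivative[OF bounded_bilinear_inner] tangent_deriv s)
  moreover have "((\<lambda>x. \<tau> x \<bullet> \<tau> x) has_vector_derivative 0) (at s)"
    by (rule has_vector_derivative_transform_within_open[OF has_vector_derivative_const[of 1] open_I s])
       (simp add: tangent_tangent)
  ultimately show ?thesis
    using vector_derivative_unique_at by (fastforce simp: inner_commute)
qed

text \<open>Otherwise \<open>t = arccos (1 / (r * norm (\<nu> s)))\<close> would violate the
  regularity condition.\<close>

lemma radius_curvature_less_1:
  assumes s: "s \<in> I"
  shows "r * norm (\<nu> s) < 1"
proof (rule ccontr)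
  assume *: "\<not> r * norm (\<nu> s) < 1"
  define k where "k = r * norm (\<nu> s)"
  have k: "k \<ge> 1" using * by (simp add: k_def)
  have "cos (arccos (1 / k)) = 1 / k" using k
    by (intro cos_arccos) (auto simp: field_simps)
  then have "1 - k * cos (arccos (1 / k)) = 0" using k by simp
  then show False
    using regular s by (simp add: regular_tubular_surface_def curve_curvature_def k_def)
qed

lemma in_tube_domain_iff: "(s, v) \<in> tube_domain T \<longleftrightarrow> s \<in> I \<and> norm v = 1 \<and> v \<bullet> \<tau> s = 0"
  by (simp add: tube_domain_def)

text \<open>Cauchy-Schwarz bounds \<open>v \<bullet> \<nu> s\<close> by the curvature. This factor
  measures how the immersion stretches the axial direction and reappears as a denominator in the
  curvatures.\<close>

lemma regularity_factor_pos:
  assumes p: "(s, v) \<in> tube_domain T"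
  shows "1 - r * (v \<bullet> \<nu> s) > 0"
proof -
  have s: "s \<in> I" and v: "norm v = 1" using p by (auto simp: in_tube_domain_iff)
  have "v \<bullet> \<nu> s \<le> norm (\<nu> s)" using norm_cauchy_schwarz[of v "\<nu> s"] v by simp
  then have "r * (v \<bullet> \<nu> s) \<le> r * norm (\<nu> s)" using r_pos by simp
  then show ?thesis using radius_curvature_less_1[OF s] by simp
qed

section \<open>Differentials and tangent vectors\<close>

lemma frechet_derivative_tube_map:
  assumes "s \<in> I"
  shows "frechet_derivative (tube_map T) (at (s, v)) = (\<lambda>w. fst w *\<^sub>R \<tau> s + r *\<^sub>R snd w)"
proof -
  have \<gamma>: "(\<gamma> has_derivative (\<lambda>h. h *\<^sub>R \<tau> s)) (at (fst (s, v)))"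
    using curve_deriv[OF assms] by (simp add: has_vector_derivative_def)
  have "((\<lambda>p. \<gamma> (fst p)) has_derivative (\<lambda>w. fst w *\<^sub>R \<tau> s)) (at (s, v))"
    by (rule has_derivative_compose[where f = fst and g = \<gamma>, OF _ \<gamma>])
      (auto intro!: derivative_eq_intros)
  then have "((\<lambda>p. \<gamma> (fst p) + r *\<^sub>R snd p) has_derivative (\<lambda>w. fst w *\<^sub>R \<tau> s + r *\<^sub>R snd w)) (at (s, v))"
    by (auto intro!: derivative_eq_intros)
  then have "(tube_map T has_derivative (\<lambda>w. fst w *\<^sub>R \<tau> s + r *\<^sub>R snd w)) (at (s, v))"
    by (simp add: tube_map_def case_prod_unfold)
  then show ?thesis by (rule frechet_derivative_at[symmetric])
qed

lemma frechet_derivative_tube_normal: "frechet_derivative tube_normal (at p) = (\<lambda>w. - snd w)"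
proof -
  have "((\<lambda>p. - snd p) has_derivative (\<lambda>w. - snd w)) (at p)"
    by (auto intro!: derivative_eq_intros)
  then have "(tube_normal has_derivative (\<lambda>w. - snd w)) (at p)"
    by (simp add: tube_normal_def case_prod_unfold)
  then show ?thesis by (rule frechet_derivative_at[symmetric])
qed

text \<open>Differentiating the constants \<open>v \<bullet> v = 1\<close> and
  \<open>v \<bullet> \<tau> s = 0\<close> along a curve in the domain gives these linear conditions
  on its velocity.\<close>

lemma tangent_space_tube_domainD:
  assumes p: "(s, v) \<in> tube_domain T" and w: "(\<sigma>, y) \<in> tangent_space (tube_domain T) (s, v)"
  shows "y \<bullet> v = 0" "y \<bullet> \<tau> s = - \<sigma> * (v \<bullet> \<nu> s)"
proof -
  have s: "s \<in> I" using p by (auto simp: in_tube_domain_iff)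
  obtain c where c0: "c 0 = (s, v)" and ev: "\<forall>\<^sub>F t in nhds (0::real). c t \<in> tube_domain T"
    and cd: "(c has_vector_derivative (\<sigma>, y)) (at 0)"
    using w by (auto simp: tangent_space_def)
  obtain U where U: "open U" "0 \<in> U" "\<And>t. t \<in> U \<Longrightarrow> c t \<in> tube_domain T"
    using ev by (auto simp: eventually_nhds)
  have d1: "((\<lambda>t. fst (c t)) has_vector_derivative \<sigma>) (at 0)"
    using cd has_derivative_fst by (fastforce simp: has_vector_derivative_def)
  have d2: "((\<lambda>t. snd (c t)) has_vector_derivative y) (at 0)"
    using cd has_derivative_snd by (fastforce simp: has_vector_derivative_def)
  have dt: "((\<lambda>t. \<tau> (fst (c t))) has_vector_derivative \<sigma> *\<^sub>R \<nu> s) (at 0)"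
    using vector_diff_chain_at[OF d1, of \<tau> "\<nu> s"] tangent_deriv[OF s] c0 by (simp add: o_def)
  have U': "norm (snd (c t)) = 1" "snd (c t) \<bullet> \<tau> (fst (c t)) = 0" if "t \<in> U" for t
    using U(3)[OF that] by (cases "c t"; simp add: in_tube_domain_iff)+
  have "((\<lambda>t. snd (c t) \<bullet> snd (c t)) has_vector_derivative snd (c 0) \<bullet> y + y \<bullet> snd (c 0)) (at 0)"
    by (intro bounded_bilinear.has_vector_derivative[OF bounded_bilinear_inner] d2)
  moreover have "((\<lambda>t. snd (c t) \<bullet> snd (c t)) has_vector_derivative 0) (at 0)"
    by (rule has_vector_derivative_transform_within_open[OF has_vector_derivative_const[of 1] U(1,2)])
       (metis U'(1) norm_eq_1)
  ultimately have "snd (c 0) \<bullet> y + y \<bullet> snd (c 0) = 0" by (rule vector_derivative_unique_at)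
  then show "y \<bullet> v = 0" using c0 by (simp add: inner_commute)
  have "((\<lambda>t. snd (c t) \<bullet> \<tau> (fst (c t))) has_vector_derivative
      snd (c 0) \<bullet> (\<sigma> *\<^sub>R \<nu> s) + y \<bullet> \<tau> (fst (c 0))) (at 0)"
    by (intro bounded_bilinear.has_vector_derivative[OF bounded_bilinear_inner] d2 dt)
  moreover have "((\<lambda>t. snd (c t) \<bullet> \<tau> (fst (c t))) has_vector_derivative 0) (at 0)"
    by (rule has_vector_derivative_transform_within_open[OF has_vector_derivative_const[of 0] U(1,2)])
       (simp add: U'(2))
  ultimately have "snd (c 0) \<bullet> (\<sigma> *\<^sub>R \<nu> s) + y \<bullet> \<tau> (fst (c 0)) = 0"
    by (rule vector_derivative_unique_at)
  then show "y \<bullet> \<tau> s = - \<sigma> * (v \<bullet> \<nu> s)" using c0 by simp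
qed

text \<open>The curve fixes \<open>s\<close> and rotates \<open>v\<close> in the normal plane with
  angular velocity \<open>k\<close>.\<close>

lemma circle_direction_tangent:
  assumes p: "(s, v) \<in> tube_domain T"
  shows "(0, k *\<^sub>R cross3 (\<tau> s) v) \<in> tangent_space (tube_domain T) (s, v)"
proof -
  define e where "e = cross3 (\<tau> s) v"
  have s: "s \<in> I" and v: "norm v = 1" "v \<bullet> \<tau> s = 0" using p by (auto simp: in_tube_domain_iff)
  have ee: "e \<bullet> e = 1"
    using norm_cross3_orthonormal[OF norm_tangent[OF s] v] by (simp add: e_def norm_eq_1)
  have vv: "v \<bullet> v = 1" using v by (simp add: norm_eq_1)
  have ev: "e \<bullet> v = 0" "v \<bullet> e = 0" "e \<bullet> \<tau> s = 0" by (simp_all add: e_def dot_cross_self)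
  define c where "c = (\<lambda>t::real. (s, cos (k * t) *\<^sub>R v + sin (k * t) *\<^sub>R e))"
  have "c t \<in> tube_domain T" for t
  proof -
    have "norm (cos (k * t) *\<^sub>R v + sin (k * t) *\<^sub>R e) = 1"
      unfolding norm_eq_1
      using sin_cos_squared_add2[of "k * t"]
      by (simp add: inner_add_left inner_add_right vv ee ev power2_eq_square)
    then show ?thesis using s v ev by (simp add: c_def in_tube_domain_iff inner_add_left)
  qed
  moreover have "(c has_vector_derivative (0, k *\<^sub>R e)) (at 0)"
  proof -
    have "((\<lambda>t. cos (k * t) *\<^sub>R v + sin (k * t) *\<^sub>R e) has_vector_derivative k *\<^sub>R e) (at 0)"
      by (auto intro!: derivative_eq_intros)
    then show ?thesis unfolding c_def
      by (intro has_vector_derivative_Pair has_vector_derivative_const)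
  qed
  ultimately show ?thesis unfolding tangent_space_def e_def[symmetric]
    by (intro CollectI exI[of _ c]) (auto simp: c_def)
qed

text \<open>Moving \<open>s\<close> alone would destroy the orthogonality of \<open>v\<close> to the
  tangent. So \<open>v\<close> is projected to the normal plane at the new point and normalized. The
  projection has its derivative along \<open>\<tau> s\<close>, orthogonal to \<open>v\<close>, hence
  normalizing preserves that derivative.\<close>

lemma axial_direction_tangent:
  assumes p: "(s, v) \<in> tube_domain T"
  shows "(k, - (k * (v \<bullet> \<nu> s)) *\<^sub>R \<tau> s) \<in> tangent_space (tube_domain T) (s, v)"
proof -
  have s: "s \<in> I" and v: "norm v = 1" "v \<bullet> \<tau> s = 0" using p by (auto simp: in_tube_domain_iff)
  define h where "h = (\<lambda>t::real. s + t * k)"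
  define f where "f = (\<lambda>t. v - (v \<bullet> \<tau> (h t)) *\<^sub>R \<tau> (h t))"
  define c where "c = (\<lambda>t. (h t, f t /\<^sub>R norm (f t)))"
  have h0: "h 0 = s" and f0: "f 0 = v" using v by (simp_all add: h_def f_def)
  have hd: "(h has_vector_derivative k) (at 0)"
    unfolding h_def by (auto intro!: derivative_eq_intros)
  have td: "((\<lambda>t. \<tau> (h t)) has_vector_derivative k *\<^sub>R \<nu> s) (at 0)"
    using vector_diff_chain_at[OF hd, of \<tau> "\<nu> s"] tangent_deriv[OF s] h0 by (simp add: o_def)
  have vt: "((\<lambda>t. v \<bullet> \<tau> (h t)) has_vector_derivative k * (v \<bullet> \<nu> s)) (at 0)"
    using bounded_linear.has_vector_derivative[OF bounded_linear_inner_right td, of v] by simp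
  have "(f has_vector_derivative
      0 - ((v \<bullet> \<tau> (h 0)) *\<^sub>R (k *\<^sub>R \<nu> s) + (k * (v \<bullet> \<nu> s)) *\<^sub>R \<tau> (h 0))) (at 0)"
    unfolding f_def
    by (intro has_vector_derivative_diff has_vector_derivative_const
        bounded_bilinear.has_vector_derivative[OF bounded_bilinear_scaleR] vt td)
  then have fd: "(f has_vector_derivative - (k * (v \<bullet> \<nu> s)) *\<^sub>R \<tau> s) (at 0)"
    using v by (simp add: h0)
  have nd: "((\<lambda>t. f t /\<^sub>R norm (f t)) has_vector_derivative - (k * (v \<bullet> \<nu> s)) *\<^sub>R \<tau> s) (at 0)"
    using v f0 by (intro has_vector_derivative_normalize[OF fd]) simp_all
  have cd: "(c has_vector_derivative (k, - (k * (v \<bullet> \<nu> s)) *\<^sub>R \<tau> s)) (at 0)"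
    unfolding c_def by (intro has_vector_derivative_Pair hd nd)
  have hc: "(h \<longlongrightarrow> s) (nhds 0)"
    using has_vector_derivative_continuous[OF hd] tendsto_at_iff_tendsto_nhds[of h 0] h0
    by (simp add: continuous_within)
  have fc: "(f \<longlongrightarrow> v) (nhds 0)"
    using has_vector_derivative_continuous[OF fd] tendsto_at_iff_tendsto_nhds[of f 0] f0
    by (simp add: continuous_within)
  \<comment> \<open>For \<open>t\<close> near 0 the base point stays in the interval and the
    projected vector is nonzero, so its normalization is a unit vector.\<close>
  have "\<forall>\<^sub>F t in nhds 0. h t \<in> I" using topological_tendstoD[OF hc open_I s] .
  moreover have "\<forall>\<^sub>F t in nhds 0. f t \<noteq> 0"
    using v(1) by (intro tendsto_imp_eventually_ne[OF fc]) auto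
  ultimately have "\<forall>\<^sub>F t in nhds 0. c t \<in> tube_domain T"
  proof eventually_elim
    case (elim t)
    have "f t \<bullet> \<tau> (h t) = 0"
      using tangent_tangent[OF elim(1)] by (simp add: f_def inner_diff_left)
    then show ?case using elim by (simp add: c_def in_tube_domain_iff)
  qed
  then show ?thesis using cd f0 v
    unfolding tangent_space_def by (intro CollectI exI[of _ c]) (simp add: c_def h0)
qed

section \<open>Principal curvatures\<close>

lemma principal_curvatures_tube:
  assumes p: "(s, v) \<in> tube_domain T"
  shows "principal_curvatures (tube_domain T) (tube_map T) tube_normal (s, v)
    (1 / r) (- (v \<bullet> \<nu> s) / (1 - r * (v \<bullet> \<nu> s)))"
proof -
  define u where "u = v \<bullet> \<nu> s"
  define e where "e = cross3 (\<tau> s) v"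
  have s: "s \<in> I" and v: "norm v = 1" "v \<bullet> \<tau> s = 0" using p by (auto simp: in_tube_domain_iff)
  have pos: "1 - r * u > 0" using regularity_factor_pos[OF p] by (simp add: u_def)
  \<comment> \<open>This scaling makes the differential of \<open>tube_map\<close> send the axial
    tangent vector to the unit vector \<open>\<tau> s\<close>; the eigenvalue is then
    \<open>- (k * u)\<close>. The factor \<open>1 / r\<close> does the same for the circle
    direction, with image \<open>e\<close>.\<close>
  define k where "k = 1 / (1 - r * u)"
  have k: "k - r * (k * u) = 1" using pos by (simp add: k_def field_simps)
  have e: "norm e = 1"
    using norm_cross3_orthonormal[OF norm_tangent[OF s] v] by (simp add: e_def)
  have df: "k *\<^sub>R \<tau> s + r *\<^sub>R (- (k * u) *\<^sub>R \<tau> s) = \<tau> s"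
    using k by (simp flip: scaleR_left.diff)
  show ?thesis
    unfolding principal_curvatures_def Let_def frechet_derivative_tube_map[OF s]
      frechet_derivative_tube_normal u_def[symmetric]
  proof (rule bexI[where x = "(0, (1 / r) *\<^sub>R e)"],
      rule bexI[where x = "(k, - (k * u) *\<^sub>R \<tau> s)"], intro conjI)
    show "(0, (1 / r) *\<^sub>R e) \<in> tangent_space (tube_domain T) (s, v)"
      unfolding e_def by (rule circle_direction_tangent[OF p])
    show "(k, - (k * u) *\<^sub>R \<tau> s) \<in> tangent_space (tube_domain T) (s, v)"
      unfolding u_def by (rule axial_direction_tangent[OF p])
  qed (use r_pos e norm_tangent[OF s] df in \<open>simp_all add: e_def dot_cross_self k_def\<close>)
qed

text \<open>Needed because the curvatures are definite descriptions. In the frame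
  \<open>\<tau> s\<close>, \<open>e\<close> the shape operator is diagonal with distinct entries, so
  every eigenvector lies on an axis of the frame, and an orthonormal pair uses both axes.\<close>

lemma principal_curvatures_tube_unique:
  assumes p: "(s, v) \<in> tube_domain T"
    and pc: "principal_curvatures (tube_domain T) (tube_map T) tube_normal (s, v) k1 k2"
  defines "\<kappa>2 \<equiv> - (v \<bullet> \<nu> s) / (1 - r * (v \<bullet> \<nu> s))"
  shows "(k1 = 1 / r \<and> k2 = \<kappa>2) \<or> (k1 = \<kappa>2 \<and> k2 = 1 / r)"
proof -
  define u where "u = v \<bullet> \<nu> s"
  define e where "e = cross3 (\<tau> s) v"
  have s: "s \<in> I" and v: "norm v = 1" "v \<bullet> \<tau> s = 0" using p by (auto simp: in_tube_domain_iff)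
  have pos: "1 - r * u > 0" using regularity_factor_pos[OF p] by (simp add: u_def)
  have ee: "e \<bullet> e = 1"
    using norm_cross3_orthonormal[OF norm_tangent[OF s] v] by (simp add: e_def norm_eq_1)
  have et: "e \<bullet> \<tau> s = 0" "\<tau> s \<bullet> e = 0" by (simp_all add: e_def dot_cross_self)
  note tt = tangent_tangent[OF s]
  have \<kappa>2: "\<kappa>2 = - u / (1 - r * u)" by (simp add: \<kappa>2_def u_def)
  \<comment> \<open>No point is umbilic: \<open>1 / r - \<kappa>2\<close> equals
    \<open>1 / (r * (1 - r * u))\<close>.\<close>
  have ne: "\<kappa>2 \<noteq> 1 / r" using pos r_pos by (auto simp: \<kappa>2 field_simps)
  define df where "df = (\<lambda>w::real \<times> (real^3). fst w *\<^sub>R \<tau> s + r *\<^sub>R snd w)"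
  \<comment> \<open>For tangent \<open>w\<close>, \<open>x w\<close> and \<open>y w\<close> are the
    coordinates of \<open>df w\<close> along \<open>\<tau> s\<close> and \<open>e\<close>. The term
    \<open>- r * u\<close> comes from the component of \<open>snd w\<close> along
    \<open>\<tau> s\<close>, which is forced by tangency.\<close>
  define x where "x = (\<lambda>w::real \<times> (real^3). (1 - r * u) * fst w)"
  define y where "y = (\<lambda>w::real \<times> (real^3). r * (snd w \<bullet> e))"
  have coords: "df w = x w *\<^sub>R \<tau> s + y w *\<^sub>R e \<and> snd w = (\<kappa>2 * x w) *\<^sub>R \<tau> s + (1 / r * y w) *\<^sub>R e"
    if "w \<in> tangent_space (tube_domain T) (s, v)" for w
  proof -
    obtain \<sigma> z where w: "w = (\<sigma>, z)" by (cases w)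
    from tangent_space_tube_domainD[OF p that[unfolded w]]
    have z: "z \<bullet> v = 0" "z \<bullet> \<tau> s = - \<sigma> * u" by (simp_all add: u_def)
    define m where "m = z \<bullet> e"
    have exp: "z = (- \<sigma> * u) *\<^sub>R \<tau> s + m *\<^sub>R e"
      using orthonormal_expansion_cross3[OF norm_tangent[OF s] v z(1)] z(2) by (simp add: e_def m_def)
    have "r *\<^sub>R z = (- r * \<sigma> * u) *\<^sub>R \<tau> s + (r * m) *\<^sub>R e"
      unfolding exp by (simp add: scaleR_right_diff_distrib mult.assoc)
    then have "df w = x w *\<^sub>R \<tau> s + y w *\<^sub>R e"
      by (simp add: df_def x_def y_def w algebra_simps flip: m_def)
    moreover have "\<kappa>2 * x w = - \<sigma> * u" "1 / r * y w = m"
      using pos r_pos by (simp_all add: \<kappa>2 x_def y_def w m_def field_simps)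
    ultimately show ?thesis using exp w by simp
  qed
  have inner_coords: "(\<alpha> *\<^sub>R \<tau> s + \<beta> *\<^sub>R e) \<bullet> (\<alpha>' *\<^sub>R \<tau> s + \<beta>' *\<^sub>R e) = \<alpha> * \<alpha>' + \<beta> * \<beta>'"
    for \<alpha> \<beta> \<alpha>' \<beta>' by (simp add: inner_add_left inner_add_right tt ee et)
  \<comment> \<open>Since \<open>snd w\<close> is minus the differential of the normal, the
    hypothesis on \<open>k\<close> is the eigenvalue equation; its components along
    \<open>\<tau> s\<close> and \<open>e\<close> are compared.\<close>
  have eigen: "x w = 0 \<or> k = \<kappa>2" "y w = 0 \<or> k = 1 / r"
    if w: "w \<in> tangent_space (tube_domain T) (s, v)" and k: "snd w = k *\<^sub>R df w" for w k
  proof -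
    have "k *\<^sub>R df w = (k * x w) *\<^sub>R \<tau> s + (k * y w) *\<^sub>R e"
      using coords[OF w] by (simp add: scaleR_add_right)
    then have *: "(\<kappa>2 * x w) *\<^sub>R \<tau> s + (1 / r * y w) *\<^sub>R e = (k * x w) *\<^sub>R \<tau> s + (k * y w) *\<^sub>R e"
      using coords[OF w, THEN conjunct2] k by (simp only:)
    from arg_cong[OF *, of "\<lambda>z. z \<bullet> \<tau> s"] have "\<kappa>2 * x w = k * x w"
      by (simp add: inner_add_left tt et)
    then show "x w = 0 \<or> k = \<kappa>2" by auto
    from arg_cong[OF *, of "\<lambda>z. z \<bullet> e"] have "1 / r * y w = k * y w"
      by (simp add: inner_add_left ee et)
    then show "y w = 0 \<or> k = 1 / r" by (metis mult_right_cancel)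
  qed
  obtain w1 w2 where
    w1: "w1 \<in> tangent_space (tube_domain T) (s, v)" and
    w2: "w2 \<in> tangent_space (tube_domain T) (s, v)" and
    on: "norm (df w1) = 1" "norm (df w2) = 1" "df w1 \<bullet> df w2 = 0" and
    k: "snd w1 = k1 *\<^sub>R df w1" "snd w2 = k2 *\<^sub>R df w2"
    using pc unfolding principal_curvatures_def Let_def frechet_derivative_tube_map[OF s]
      frechet_derivative_tube_normal df_def by auto
  have n: "x w1 * x w1 + y w1 * y w1 = 1" "x w2 * x w2 + y w2 * y w2 = 1"
    "x w1 * x w2 + y w1 * y w2 = 0"
    using on coords[OF w1] coords[OF w2] by (simp_all add: norm_eq_1 inner_coords)
  note e1 = eigen[OF w1 k(1)] and e2 = eigen[OF w2 k(2)]
  show ?thesis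
  proof (cases "x w1 = 0")
    case True
    then have "y w1 \<noteq> 0" "y w2 = 0" using n by auto
    moreover from this have "x w2 \<noteq> 0" using n by auto
    ultimately show ?thesis using e1 e2 by blast
  next
    case False
    then have "y w1 = 0" using e1 ne by auto
    then have "x w2 = 0" using n False by simp
    then have "y w2 \<noteq> 0" using n by auto
    then show ?thesis using e1 e2 False by blast
  qed
qed

text \<open>The principal curvatures are unique up to a swap, which does not affect their product,
  so the description of \<open>K\<close> has exactly one value. The same holds for their sum in
  \<open>tube_H_eq\<close>.\<close>

lemma tube_K_eq:
  assumes p: "(s, v) \<in> tube_domain T"
  shows "tube_K T (s, v) = - (v \<bullet> \<nu> s) / (r * (1 - r * (v \<bullet> \<nu> s)))"
  unfolding tube_K_def gaussian_curvature_def
proof (rule the_equality)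
  show "\<exists>k1 k2. principal_curvatures (tube_domain T) (tube_map T) tube_normal (s, v) k1 k2 \<and>
    - (v \<bullet> \<nu> s) / (r * (1 - r * (v \<bullet> \<nu> s))) = k1 * k2"
    using principal_curvatures_tube[OF p] by (intro exI conjI) auto
qed (use principal_curvatures_tube_unique[OF p] in fastforce)

lemma tube_H_eq:
  assumes p: "(s, v) \<in> tube_domain T"
  shows "tube_H T (s, v) = (1 / r - (v \<bullet> \<nu> s) / (1 - r * (v \<bullet> \<nu> s))) / 2"
  unfolding tube_H_def mean_curvature_def
proof (rule the_equality)
  show "\<exists>k1 k2. principal_curvatures (tube_domain T) (tube_map T) tube_normal (s, v) k1 k2 \<and>
    (1 / r - (v \<bullet> \<nu> s) / (1 - r * (v \<bullet> \<nu> s))) / 2 = (k1 + k2) / 2"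
    using principal_curvatures_tube[OF p] by (intro exI conjI) auto
qed (use principal_curvatures_tube_unique[OF p] in fastforce)

section \<open>The linear Weingarten relation\<close>

text \<open>The relation is multiplied by \<open>2 * r * d\<close>, where
  \<open>d = 1 - r * (v \<bullet> \<nu> s)\<close> is nonzero by regularity.\<close>

lemma weingarten_relation_iff:
  assumes p: "(s, v) \<in> tube_domain T"
  shows "a * tube_K T (s, v) + b * tube_H T (s, v) - c = 0 \<longleftrightarrow>
    b * (1 - 2 * r * (v \<bullet> \<nu> s)) - 2 * a * (v \<bullet> \<nu> s) = 2 * c * r * (1 - r * (v \<bullet> \<nu> s))"
proof -
  define u where "u = v \<bullet> \<nu> s"
  define d where "d = 1 - r * u"
  have d: "d \<noteq> 0" using regularity_factor_pos[OF p] by (simp add: d_def u_def)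
  have r: "r \<noteq> 0" using r_pos by simp
  have "a * (- u / (r * d)) + b * ((1 / r - u / d) / 2) - c
    = (b * (d - r * u) - 2 * a * u - 2 * c * r * d) / (2 * r * d)"
    using d r by (simp add: field_simps)
  moreover have "d - r * u = 1 - 2 * r * u" by (simp add: d_def)
  ultimately show ?thesis using d r
    by (simp add: tube_K_eq[OF p] tube_H_eq[OF p] flip: u_def d_def)
qed

text \<open>At such a point the tube has the curvatures of a cylinder, \<open>K = 0\<close> and
  \<open>H = 1 / (2 * r)\<close>, so the relation there involves only the radius.\<close>

lemma exists_normal_orthogonal_to_curvature:
  assumes "s \<in> I"
  obtains v where "(s, v) \<in> tube_domain T" "v \<bullet> \<nu> s = 0"
  using exists_unit_orthogonal_to_two[of "\<tau> s" "\<nu> s"] assms by (metis in_tube_domain_iff)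

text \<open>The witness is the principal normal of the curve, which is orthogonal to the unit
  tangent.\<close>

lemma exists_normal_not_orthogonal_to_curvature:
  assumes s: "s \<in> I" and "\<nu> s \<noteq> 0"
  obtains v where "(s, v) \<in> tube_domain T" "v \<bullet> \<nu> s \<noteq> 0"
proof
  show "(s, \<nu> s /\<^sub>R norm (\<nu> s)) \<in> tube_domain T" "(\<nu> s /\<^sub>R norm (\<nu> s)) \<bullet> \<nu> s \<noteq> 0"
    using assms tangent_curvature_orthogonal[OF s] by (simp_all add: in_tube_domain_iff inner_commute)
qed

lemma linear_weingarten_iff:
  "(\<forall>p\<in>tube_domain T. a * tube_K T p + b * tube_H T p - c = 0) \<longleftrightarrow>
    b = 2 * c * r \<and> (right_cylinder T \<or> 2 * a + b * r = 0)" (is "?W \<longleftrightarrow> ?R")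
proof
  assume W: ?W
  have W': "b * (1 - 2 * r * (v \<bullet> \<nu> s)) - 2 * a * (v \<bullet> \<nu> s) = 2 * c * r * (1 - r * (v \<bullet> \<nu> s))"
    if "(s, v) \<in> tube_domain T" for s v
    using W that weingarten_relation_iff[OF that] by blast
  obtain s where "s \<in> I" using I_nonempty by blast
  then obtain v where "(s, v) \<in> tube_domain T" "v \<bullet> \<nu> s = 0"
    by (rule exists_normal_orthogonal_to_curvature)
  then have b: "b = 2 * c * r" using W'[of s v] by simp
  \<comment> \<open>The coefficient \<open>2 * a + b * r\<close> does not depend on
    \<open>s\<close>; if it is nonzero, the curvature vanishes on the whole interval and the tube is
    a right cylinder.\<close>
  have "\<nu> s = 0" if s: "s \<in> I" and ne: "2 * a + b * r \<noteq> 0" for s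
  proof (rule ccontr)
    assume "\<nu> s \<noteq> 0"
    then obtain v where v: "(s, v) \<in> tube_domain T" "v \<bullet> \<nu> s \<noteq> 0"
      using exists_normal_not_orthogonal_to_curvature s by blast
    \<comment> \<open>With \<open>b = 2 * c * r\<close> the constant terms cancel, leaving an
      expression linear in \<open>v \<bullet> \<nu> s\<close>.\<close>
    have "(2 * a + b * r) * (v \<bullet> \<nu> s) = 0"
      using W'[OF v(1)] unfolding b by (simp add: algebra_simps)
    then show False using v ne by simp
  qed
  then show ?R
    using b regular by (auto simp: right_cylinder_def curve_curvature_def)
next
  assume R: ?R
  have "a * tube_K T (s, v) + b * tube_H T (s, v) - c = 0" if p: "(s, v) \<in> tube_domain T" for s v
  proof -
    have "s \<in> I" using p by (simp add: in_tube_domain_iff)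
    then have "(2 * a + b * r) * (v \<bullet> \<nu> s) = 0"
      using R by (auto simp: right_cylinder_def curve_curvature_def)
    then have "b * (1 - 2 * r * (v \<bullet> \<nu> s)) - 2 * a * (v \<bullet> \<nu> s) = b * (1 - r * (v \<bullet> \<nu> s))"
      by (simp add: algebra_simps)
    then show ?thesis unfolding weingarten_relation_iff[OF p] using R by simp
  qed
  then show ?W by auto
qed

end

section \<open>The solution sets\<close>

lemma mem_linear_weingarten_tubes:
  "T \<in> weingarten_tubes (\<lambda>x y. a * x + b * y - c) \<longleftrightarrow>
    regular_tubular_surface T \<and> b = 2 * c * radius T \<and>
    (right_cylinder T \<or> 2 * a + b * radius T = 0)"
  using regular_tube.linear_weingarten_iff[of T a b c]
  by (auto simp: weingarten_tubes_def regular_tube_def)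

text \<open>The central curve is the first coordinate axis at unit speed; its curvature is zero, so
  the regularity condition reads \<open>1 \<noteq> 0\<close> for every radius.\<close>

lemma exists_right_cylinder:
  assumes "\<rho> > 0"
  obtains T where "right_cylinder T" "radius T = \<rho>"
proof -
  define g :: "real \<Rightarrow> real^3" where "g = (\<lambda>s. s *\<^sub>R axis 1 1)"
  define T where "T = \<lparr>left_end = - \<infinity>, right_end = \<infinity>, central_curve = g, radius = \<rho>\<rparr>"
  have "(g has_vector_derivative axis 1 1) (at s)" for s
    unfolding g_def by (auto intro!: derivative_eq_intros)
  then have d1: "vector_derivative g (at s) = axis 1 1" for s
    by (rule vector_derivative_at)
  \<comment> \<open>The index is shifted: \<open>n = 0\<close> is the constant first derivative, and
    all later ones vanish.\<close>
  have nd: "nth_derivative (Suc n) g = (\<lambda>s. if n = 0 then axis 1 1 else 0)" for n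
    by (induction n) (simp_all add: nth_derivative_def d1)
  have "nth_derivative n g differentiable at s" for n s
  proof (cases n)
    case 0
    then show ?thesis by (simp add: nth_derivative_def g_def)
  qed (simp add: nd)
  then have "smooth_curve_on (param_interval T) g" by (simp add: smooth_curve_on_def)
  moreover have "nth_derivative 1 g = (\<lambda>s. axis 1 1)" "nth_derivative 2 g = (\<lambda>s. 0)"
    using nd[of 0] nd[of 1] by (simp_all add: numeral_2_eq_2)
  ultimately have "right_cylinder T"
    using assms
    by (simp add: right_cylinder_def regular_tubular_surface_def tubular_surface_def
        curve_curvature_def T_def)
  then show ?thesis using that by (simp add: T_def)
qed

theorem corollary6:
  fixes a b c \<Delta> :: real and Q :: "real \<Rightarrow> real \<Rightarrow> real"
  assumes ab: "(a, b) \<noteq> (0, 0)"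
    and Q: "Q = (\<lambda>x y. a * x + b * y - c)"
    and \<Delta>: "\<Delta> = b^2 + 4 * a * c"
  shows "(weingarten_tubes Q \<noteq> {} \<longleftrightarrow> (b = 0 \<and> c = 0) \<or> b * c > 0) \<and>
    (b = 0 \<and> c = 0 \<longrightarrow> weingarten_tubes Q = {T. right_cylinder T}) \<and>
    (b * c > 0 \<and> \<Delta> = 0 \<longrightarrow>
       weingarten_tubes Q = {T. regular_tubular_surface T \<and> radius T = b / (2 * c)}) \<and>
    (b * c > 0 \<and> \<Delta> \<noteq> 0 \<longrightarrow>
       weingarten_tubes Q = {T. right_cylinder T \<and> radius T = b / (2 * c)})"
proof -
  note mem = mem_linear_weingarten_tubes[of _ a b c, folded Q]
  have cyl: "right_cylinder T \<Longrightarrow> regular_tubular_surface T" for T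
    by (simp add: right_cylinder_def)
  have rad: "b = 2 * c * \<rho> \<longleftrightarrow> \<rho> = b / (2 * c)" if "b * c > 0" for \<rho>
    using that by (auto simp: field_simps)
  \<comment> \<open>At the forced radius \<open>b / (2 * c)\<close> the second alternative of
    \<open>mem\<close> is the discriminant condition, as its left side equals
    \<open>\<Delta> / (2 * c)\<close>.\<close>
  have \<Delta>0: "2 * a + b * (b / (2 * c)) = 0 \<longleftrightarrow> \<Delta> = 0" if "b * c > 0"
  proof -
    have "c \<noteq> 0" using that by auto
    then have "2 * a + b * (b / (2 * c)) = \<Delta> / (2 * c)"
      by (simp add: \<Delta> field_simps power2_eq_square)
    then show ?thesis using \<open>c \<noteq> 0\<close> by simp
  qed
  \<comment> \<open>Here the radius equation reads \<open>0 = 0\<close>, and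
    \<open>a \<noteq> 0\<close> rules out the alternative
    \<open>2 * a + b * radius T = 0\<close>.\<close>
  have i: "weingarten_tubes Q = {T. right_cylinder T}" if "b = 0" "c = 0"
    using that ab cyl by (auto simp: mem)
  have mem_pos: "T \<in> weingarten_tubes Q \<longleftrightarrow>
      regular_tubular_surface T \<and> radius T = b / (2 * c) \<and> (right_cylinder T \<or> \<Delta> = 0)"
    if "b * c > 0" for T
    unfolding mem rad[OF that] using \<Delta>0[OF that] by metis
  have ii: "weingarten_tubes Q = {T. regular_tubular_surface T \<and> radius T = b / (2 * c)}"
    if "b * c > 0" "\<Delta> = 0"
    using mem_pos[OF that(1)] that(2) by blast
  have iii: "weingarten_tubes Q = {T. right_cylinder T \<and> radius T = b / (2 * c)}"
    if "b * c > 0" "\<Delta> \<noteq> 0"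
    using mem_pos[OF that(1)] that(2) cyl by blast
  have "(b = 0 \<and> c = 0) \<or> b * c > 0" if "T \<in> weingarten_tubes Q" for T
  proof -
    have b: "b = 2 * c * radius T" and r: "radius T > 0"
      using that by (auto simp: mem regular_tubular_surface_def tubular_surface_def)
    \<comment> \<open>A positive radius makes \<open>b * c\<close> positive unless
      \<open>c = 0\<close>, in which case \<open>b = 0\<close> too.\<close>
    have bc: "b * c = 2 * radius T * c\<^sup>2" by (simp add: b power2_eq_square)
    show ?thesis
    proof (cases "c = 0")
      case False
      then show ?thesis unfolding bc using r by simp
    qed (simp add: b)
  qed
  moreover have "weingarten_tubes Q \<noteq> {}" if bc: "(b = 0 \<and> c = 0) \<or> b * c > 0"
  proof -
    \<comment> \<open>For \<open>c = 0\<close> every radius is admissible and 1 is an arbitrary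
      choice; otherwise the radius is forced, and it is positive because
      \<open>b * c > 0\<close>.\<close>
    define \<rho> where "\<rho> = (if c = 0 then 1 else b / (2 * c))"
    have "\<rho> > 0" using bc by (auto simp: \<rho>_def zero_less_divide_iff zero_less_mult_iff)
    then obtain T where "right_cylinder T" "radius T = \<rho>" by (rule exists_right_cylinder)
    then have "T \<in> weingarten_tubes Q" using bc cyl by (auto simp: mem \<rho>_def)
    then show ?thesis by blast
  qed
  ultimately show ?thesis using i ii iii by blast
qed

end
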